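(* Assume that every query at a vertex $v$ directs to $t_1$ and to $t_2$ with probability $p_1$ and $p_2=1-p_1$, respectively, where $\frac12<p_1<1$ is a constant. Furthermore, assume that once a query at a vertex $v$ has chosen which target it directs to, it returns any of the possible correct answers equiprobably and independently from all other queries. Then, given $t_1$, the algorithm $\mathcal{B}$ (described in the context) detects $t_2$ in $O(\Delta\log^2 n)$ queries with probability at least $\left(1-\frac{2}{n}\right)^{O(\log n)}$, where $n$ is the number of vertices and $\Delta$ the maximum degree of the graph.
   Context: All logarithms are base $2$. Graphs $G=(V,E)$, $|V|=n$, are connected, simple, undirected, with positive edge weights $w$; $d$ is the shortest-path distance, $N(v)$ is the set of neighbors of $v$, and $\Delta$ is the maximum degree. For $u\in N(v)$, $N(v,u)=\{x\in V: d(v,x)=w(vu)+d(u,x)\}$. There are two targets $t_1,t_2\in V$. For $i\in\{1,2\}$ let $E_{t_i}(v)=\{u\in N(v): t_i\in N(v,u)\}$. The possible correct answers of a query at $v$ directing to $t_i$ are the vertices of $E_{t_i}(v)$; so, having chosen $t_i$ (with probability $p_i$), the query returns each vertex of $E_{t_i}(v)$ with probability $1/|E_{t_i}(v)|$. The query does not disclose which target it directs to. If $v=t_i$, this is revealed by the query with probability $p_i$. For $S\subseteq V$ and $v\in V$, $\Gamma_S(v)=\max\{|N(v,u)\cap S|:u\in N(v)\}$. For a fixed constant $0\le\varepsilon<1$, a $(1+\varepsilon)$-median of $S$ for $\Gamma$ is a vertex $x\in V$ with $\Gamma_S(x)\le(1+\varepsilon)\min_{v\in V}\Gamma_S(v)$.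 Algorithm $\mathcal{B}$ ($t_1$ is known). Set $S\leftarrow V$ and $c\leftarrow\frac{7(1+p_1)^2}{p_1(1-p_1)^2}$. While $|S|>1$: compute an (exact or $(1+\varepsilon)$-approximate) median $v$ of $S$ with respect to $\Gamma$ and the set $E_{t_1}(v)$; query vertex $v$ $c\,\Delta\log n$ times, and let $Q(v)$ be the multiset of vertices returned. If $Q(v)\setminus E_{t_1}(v)\ne\emptyset$, pick a vertex $u\in Q(v)\setminus E_{t_1}(v)$ and set $S\leftarrow S\cap N(v,u)$; otherwise pick a most frequent vertex $u\in Q(v)$ and set $S\leftarrow S\cap N(v,u)$. When $|S|=1$, return the unique vertex of $S$. If a query reveals that the queried vertex is $t_2$, then $t_2$ is detected and the algorithm stops; a response revealing that the queried vertex is $t_1$ is not put in $Q(v)$. The constants in $O(\cdot)$ may depend on $p_1$ and $\varepsilon$. *)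

theory Defs
  imports
    "HOL-Probability.Probability"
    "HOL-Library.Multiset"
    "Graph_Theory.Graph_Theory"
begin

text \<open>
  An undirected simple graph is a finite symmetric loop-free digraph (\<open>pair_graph\<close>): the edge
  \<open>uv\<close> is the pair of arcs \<open>(u,v)\<close> and \<open>(v,u)\<close>, which carry the same weight.
  The shortest-path distance \<open>\<mu> w u v\<close> of the library has type \<open>ereal\<close>.
\<close>

locale weighted_graph = pair_graph G for G :: "'a pair_pre_digraph" +
  fixes w :: "'a \<times> 'a \<Rightarrow> real"
  assumes connected_graph: "Digraph_Component.connected (with_proj G)"
    and weight_pos: "(u, v) \<in> parcs G \<Longrightarrow> w (u, v) > 0"
    and weight_sym: "(u, v) \<in> parcs G \<Longrightarrow> w (u, v) = w (v, u)"

datatype target = T1 | T2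

datatype 'a response = Revealed target | Answer 'a

text \<open>The log lists all queries made so far, each with its vertex and its response.\<close>

type_synonym 'a query_log = "('a \<times> 'a response) list"

type_synonym 'a state = "'a set \<times> 'a query_log"

definition answers :: "'a response list \<Rightarrow> 'a multiset" where
  "answers rs =
     mset (List.map_filter (\<lambda>r. case r of Answer u \<Rightarrow> Some u | Revealed i \<Rightarrow> None) rs)"

text \<open>Querying stops with the first response that reveals \<open>t2\<close>.\<close>

definition until_revealed :: "'a response list \<Rightarrow> 'a response list" where
  "until_revealed rs = take (Suc (length (takeWhile (\<lambda>r. r \<noteq> Revealed T2) rs))) rs"

definition revealed :: "'a query_log \<Rightarrow> bool" where
  "revealed L \<longleftrightarrow> Revealed T2 \<in> snd ` set L"

definition detected :: "'a \<Rightarrow> 'a state \<Rightarrow> bool" where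
  "detected t2 s \<longleftrightarrow> revealed (snd s) \<or> fst s = {t2}"

definition num_queries :: "'a state \<Rightarrow> nat" where
  "num_queries s = length (snd s)"

context weighted_graph
begin

definition nbrs :: "'a \<Rightarrow> 'a set" where
  "nbrs v = {u. (v, u) \<in> parcs G}"

definition max_degree :: nat where
  "max_degree = Max ((\<lambda>v. card (nbrs v)) ` pverts G)"

definition N :: "'a \<Rightarrow> 'a \<Rightarrow> 'a set" where
  "N v u = {x \<in> pverts G. \<mu> w v x = ereal (w (v, u)) + \<mu> w u x}"

definition correct_answers :: "'a \<Rightarrow> 'a \<Rightarrow> 'a set" where
  "correct_answers t v = {u \<in> nbrs v. t \<in> N v u}"

definition \<Gamma> :: "'a set \<Rightarrow> 'a \<Rightarrow> nat" where
  "\<Gamma> S v = Max ((\<lambda>u. card (N v u \<inter> S)) ` nbrs v)"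

definition is_median :: "real \<Rightarrow> 'a set \<Rightarrow> 'a \<Rightarrow> bool" where
  "is_median \<epsilon> S x \<longleftrightarrow>
     x \<in> pverts G \<and> real (\<Gamma> S x) \<le> (1 + \<epsilon>) * real (Min (\<Gamma> S ` pverts G))"

definition query :: "real \<Rightarrow> 'a \<Rightarrow> 'a \<Rightarrow> 'a \<Rightarrow> 'a response pmf" where
  "query p1 t1 t2 v = do {
     b \<leftarrow> bernoulli_pmf p1;
     let (i, t) = (if b then (T1, t1) else (T2, t2));
     if v = t then return_pmf (Revealed i)
     else map_pmf Answer (pmf_of_set (correct_answers t v))
   }"

text \<open>
  The choices left open by the algorithm (which median, which answer) are made by arbitrary
  rules, which may depend on everything observed so far.
\<close>

definition median_rule :: "real \<Rightarrow> ('a set \<Rightarrow> 'a query_log \<Rightarrow> 'a) \<Rightarrow> bool" where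
  "median_rule \<epsilon> med \<longleftrightarrow>
     (\<forall>S L. S \<subseteq> pverts G \<and> card S > 1 \<longrightarrow> is_median \<epsilon> S (med S L))"

definition admissible_pick :: "'a \<Rightarrow> 'a \<Rightarrow> 'a multiset \<Rightarrow> 'a \<Rightarrow> bool" where
  "admissible_pick t1 v Q u \<longleftrightarrow> u \<in># Q \<and>
     (if set_mset Q - correct_answers t1 v \<noteq> {} then u \<notin> correct_answers t1 v
      else (\<forall>x. count Q x \<le> count Q u))"

definition pick_rule ::
    "'a \<Rightarrow> ('a set \<Rightarrow> 'a query_log \<Rightarrow> 'a \<Rightarrow> 'a multiset \<Rightarrow> 'a) \<Rightarrow> bool" where
  "pick_rule t1 pick \<longleftrightarrow>
     (\<forall>S L v Q. v \<in> pverts G \<and> Q \<noteq> {#} \<longrightarrow> admissible_pick t1 v Q (pick S L v Q))"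

definition batch_size :: "real \<Rightarrow> nat" where
  "batch_size p1 =
     nat \<lceil>7 * (1 + p1)\<^sup>2 / (p1 * (1 - p1)\<^sup>2) * real max_degree * log 2 (real (card (pverts G)))\<rceil>"

text \<open>
  If every response of a batch reveals \<open>t1\<close>, then no vertex can be picked and the algorithm
  aborts (\<open>None\<close>), without having detected \<open>t2\<close>.
\<close>

definition update_state ::
    "('a set \<Rightarrow> 'a query_log \<Rightarrow> 'a \<Rightarrow> 'a multiset \<Rightarrow> 'a) \<Rightarrow> 'a \<Rightarrow> 'a response list
      \<Rightarrow> 'a state \<Rightarrow> 'a state option" where
  "update_state pick v rs s =
     (let S = fst s; L = snd s @ map (Pair v) (until_revealed rs); Q = answers rs in
      if Revealed T2 \<in> set rs then Some (S, L)
      else if Q = {#} then None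
      else Some (S \<inter> N v (pick S L v Q), L))"

definition iteration ::
    "real \<Rightarrow> 'a \<Rightarrow> 'a \<Rightarrow> ('a set \<Rightarrow> 'a query_log \<Rightarrow> 'a)
      \<Rightarrow> ('a set \<Rightarrow> 'a query_log \<Rightarrow> 'a \<Rightarrow> 'a multiset \<Rightarrow> 'a) \<Rightarrow> 'a state \<Rightarrow> 'a state spmf" where
  "iteration p1 t1 t2 med pick s =
     (let v = med (fst s) (snd s) in
      map_pmf (\<lambda>rs. update_state pick v rs s)
        (replicate_pmf (batch_size p1) (query p1 t1 t2 v)))"

partial_function (spmf) loop ::
    "real \<Rightarrow> 'a \<Rightarrow> 'a \<Rightarrow> ('a set \<Rightarrow> 'a query_log \<Rightarrow> 'a)
      \<Rightarrow> ('a set \<Rightarrow> 'a query_log \<Rightarrow> 'a \<Rightarrow> 'a multiset \<Rightarrow> 'a) \<Rightarrow> 'a state \<Rightarrow> 'a state spmf" where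
  "loop p1 t1 t2 med pick s =
     (if card (fst s) > 1 \<and> \<not> revealed (snd s)
      then bind_spmf (iteration p1 t1 t2 med pick s) (loop p1 t1 t2 med pick)
      else return_spmf s)"

definition algorithm_B ::
    "real \<Rightarrow> 'a \<Rightarrow> 'a \<Rightarrow> ('a set \<Rightarrow> 'a query_log \<Rightarrow> 'a)
      \<Rightarrow> ('a set \<Rightarrow> 'a query_log \<Rightarrow> 'a \<Rightarrow> 'a multiset \<Rightarrow> 'a) \<Rightarrow> 'a state spmf" where
  "algorithm_B p1 t1 t2 med pick = loop p1 t1 t2 med pick (pverts G, [])"

end

end

theory Submission
  imports Defs
begin

text \<open>
  An exact median of \<open>S\<close> leaves at most half of \<open>S\<close> behind each neighbour, so a
  \<open>(1 + \<epsilon>)\<close>-median shrinks \<open>S\<close> by the factor \<open>(1 + \<epsilon>) / 2 < 1\<close> and \<open>O(log n)\<close>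
  iterations suffice as long as \<open>t2\<close> stays in \<open>S\<close>.  Each iteration loses \<open>t2\<close> with
  probability at most \<open>1 / n\<close>.  If \<open>v = t2\<close>, or if some correct answer \<open>y\<close> for \<open>t2\<close> is not
  correct for \<open>t1\<close>, then only a batch missing one particular response can be bad.  Otherwise
  a bad batch has an answer \<open>x\<close> that is wrong for \<open>t2\<close> and at least as frequent as \<open>y\<close>; with
  \<open>\<alpha> = 1 / sqrt p1\<close>, Markov's inequality for \<open>\<alpha> ^ (count x - count y)\<close> bounds its probability
  by \<open>(1 - (1 - sqrt p1)\<^sup>2 / \<Delta>) ^ k\<close>, where \<open>k\<close> is the batch size, and there are at most \<open>n\<close>
  choices of \<open>x\<close>.  The same bound holds for the first two cases, and the constant \<open>c\<close> of the
  algorithm makes it at most \<open>1 / n\<^sup>2\<close>.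
\<close>

subsection \<open>Exponential Markov bound for independent samples\<close>

lemma nn_integral_replicate_pmf_prod_list:
  fixes p :: "'a pmf" and g :: "'a \<Rightarrow> ennreal"
  shows "(\<integral>\<^sup>+ xs. prod_list (map g xs) \<partial>replicate_pmf k p) = (\<integral>\<^sup>+ x. g x \<partial>p) ^ k"
proof (induction k)
  case 0
  show ?case by simp
next
  case (Suc k)
  show ?case by (simp add: nn_integral_cmult nn_integral_multc Suc)
qed

lemma prod_list_ennreal:
  "(\<And>x. 0 \<le> g x) \<Longrightarrow> prod_list (map (\<lambda>x. ennreal (g x)) xs) = ennreal (prod_list (map g xs))"
proof (induction xs)
  case (Cons x xs)
  have "0 \<le> prod_list (map g xs)" using Cons.prems by (induction xs) auto
  thus ?case using Cons by (simp add: ennreal_mult)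
qed simp

text \<open>On lists drawn from the support, the product of the \<open>g\<close>-values dominates
  the indicator of \<open>A\<close>, and by independence its expectation is the \<open>k\<close>-th
  power of that of \<open>g\<close>.\<close>

lemma replicate_pmf_exponential_Markov:
  fixes p :: "'a pmf" and g :: "'a \<Rightarrow> ennreal" and a :: real
  assumes g: "(\<integral>\<^sup>+ x. g x \<partial>p) \<le> ennreal a" and "0 \<le> a"
    and A: "\<And>xs. xs \<in> A \<Longrightarrow> set xs \<subseteq> set_pmf p \<Longrightarrow> 1 \<le> prod_list (map g xs)"
  shows "measure_pmf.prob (replicate_pmf k p) A \<le> a ^ k"
proof -
  have "emeasure (replicate_pmf k p) A = (\<integral>\<^sup>+ xs. indicator A xs \<partial>replicate_pmf k p)"
    by simp
  also have "\<dots> \<le> (\<integral>\<^sup>+ xs. prod_list (map g xs) \<partial>replicate_pmf k p)"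
    using A by (intro nn_integral_mono_AE AE_pmfI)
      (auto simp: set_replicate_pmf indicator_def subset_iff in_lists_conv_set)
  also have "\<dots> \<le> ennreal a ^ k"
    unfolding nn_integral_replicate_pmf_prod_list by (intro power_mono g) auto
  finally show ?thesis
    using \<open>0 \<le> a\<close> by (simp add: measure_pmf.emeasure_eq_measure ennreal_power)
qed

text \<open>By \<open>1 + x \<le> exp x\<close>. In the application \<delta> is
  \<open>(1 - sqrt p1)\<^sup>2\<close> and \<open>k\<close> is the batch size.\<close>

lemma power_le_inverse_square:
  fixes \<delta> \<Delta> n :: real
  assumes "0 \<le> \<delta>" "\<delta> \<le> 1" "1 \<le> \<Delta>" "1 \<le> n" and k: "2 * \<Delta> * ln n \<le> \<delta> * real k"
  shows "(1 - \<delta> / \<Delta>) ^ k \<le> 1 / n\<^sup>2"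
proof -
  have "(1 - \<delta> / \<Delta>) ^ k \<le> exp (- (\<delta> / \<Delta>)) ^ k"
    using assms exp_ge_add_one_self[of "- (\<delta> / \<Delta>)"] by (intro power_mono) (auto simp: field_simps)
  also have "\<dots> = exp (- (\<delta> * real k / \<Delta>))"
    by (simp add: exp_of_nat_mult[symmetric] mult.commute)
  also have "\<dots> \<le> exp (- (2 * ln n))"
    using k assms by (simp add: field_simps)
  also have "\<dots> = 1 / n\<^sup>2"
    using assms by (simp add: exp_minus exp_double divide_inverse)
  finally show ?thesis .
qed

text \<open>Outcomes of the first experiment outside \<open>B\<close> are discarded. This serves as
  the induction step over the iterations, with \<open>B\<close> the set of good batches.\<close>

lemma measure_spmf_bind_pmf_ge:
  fixes a b :: real
  assumes "0 \<le> a" "0 \<le> b"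
    and q: "a \<le> measure (measure_pmf q) B"
    and f: "\<And>x. x \<in> B \<Longrightarrow> x \<in> set_pmf q \<Longrightarrow> b \<le> measure (measure_spmf (f x)) A"
  shows "a * b \<le> measure (measure_spmf (bind_pmf q f)) A"
proof -
  have "ennreal (a * b) \<le> emeasure (measure_pmf q) B * ennreal b"
    using assms by (auto simp: measure_pmf.emeasure_eq_measure ennreal_mult[symmetric]
      intro!: mult_right_mono ennreal_leI)
  also have "\<dots> = (\<integral>\<^sup>+ x. ennreal b * indicator B x \<partial>q)"
    by (simp add: nn_integral_cmult mult.commute)
  also have "\<dots> \<le> (\<integral>\<^sup>+ x. emeasure (measure_spmf (f x)) A \<partial>q)"
    using f by (intro nn_integral_mono_AE AE_pmfI)
      (auto simp: indicator_def measure_spmf.emeasure_eq_measure intro!: ennreal_leI)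
  also have "\<dots> = emeasure (measure_spmf (bind_pmf q f)) A"
    by (simp add: emeasure_measure_spmf_conv_measure_pmf)
  finally show ?thesis
    by (simp add: measure_spmf.emeasure_eq_measure)
qed

section \<open>Elementary inequalities for the failure rate and the batch constant\<close>

lemma one_minus_sqrt_square_le:
  fixes p :: real
  assumes "0 \<le> p" "p \<le> 1"
  shows "(1 - sqrt p)\<^sup>2 \<le> 1 - p"
proof -
  have "(1 - sqrt p)\<^sup>2 = (1 - p) - 2 * (sqrt p * (1 - sqrt p))"
    using assms by (simp add: power2_eq_square algebra_simps)
  moreover have "0 \<le> sqrt p * (1 - sqrt p)" using assms by simp
  ultimately show ?thesis by linarith
qed

text \<open>With \<open>s = sqrt p\<close> and \<open>1 - p = (1 - s) * (1 + s)\<close>, the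
  right-hand side is 7 times the square of \<open>(1 + s\<^sup>2) / (s + s\<^sup>2)\<close>, which
  is at least 1 because \<open>s < 1\<close>.\<close>

lemma batch_constant_ge:
  fixes p :: real
  assumes "0 < p" "p < 1"
  shows "7 \<le> (1 - sqrt p)\<^sup>2 * (7 * (1 + p)\<^sup>2 / (p * (1 - p)\<^sup>2))"
proof -
  define s where "s = sqrt p"
  have s: "0 < s" "s < 1" "p = s\<^sup>2" using assms by (auto simp: s_def)
  have pos: "0 < s * (1 + s) * (1 - s)" using s by simp
  have "s * (1 + s) \<le> 1 + s\<^sup>2" using s by (simp add: power2_eq_square algebra_simps)
  hence "s * (1 + s) * (1 - s) \<le> (1 - s) * (1 + p)"
    using s by (simp add: mult.commute)
  hence "1 \<le> (1 - s) * (1 + p) / (s * (1 + s) * (1 - s))"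
    by (simp only: pos_le_divide_eq[OF pos] mult_1)
  hence "7 \<le> 7 * ((1 - s) * (1 + p) / (s * (1 + s) * (1 - s)))\<^sup>2"
    using one_le_power[of _ 2] by simp
  also have "s * (1 + s) * (1 - s) = s * (1 - p)" using s by (simp add: power2_eq_square algebra_simps)
  also have "7 * ((1 - s) * (1 + p) / (s * (1 - p)))\<^sup>2 = (1 - s)\<^sup>2 * (7 * (1 + p)\<^sup>2 / (p * (1 - p)\<^sup>2))"
    using s(3) by (simp add: power_divide power_mult_distrib)
  finally show ?thesis by (simp add: s_def)
qed

subsection \<open>Responses\<close>

lemma answers_Cons:
  "answers (r # rs) = (case r of Answer u \<Rightarrow> add_mset u (answers rs) | Revealed i \<Rightarrow> answers rs)"
  "answers [] = {#}"
  by (auto simp: answers_def List.map_filter_def split: response.splits)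

lemma in_answers_iff: "u \<in># answers rs \<longleftrightarrow> Answer u \<in> set rs"
  by (induction rs) (auto simp: answers_Cons split: response.splits)

lemma answers_eq_empty_iff: "answers rs = {#} \<longleftrightarrow> (\<forall>u. Answer u \<notin> set rs)"
  by (metis in_answers_iff multiset_nonemptyE set_mset_empty empty_iff)

text \<open>The exponential weight of a Chernoff argument, factored over single responses: for
  \<open>x \<noteq> u\<close>, the factors of a batch multiply to \<alpha> raised to the difference
  of the frequencies of \<open>x\<close> and \<open>u\<close>.\<close>

definition tilt :: "real \<Rightarrow> 'a \<Rightarrow> 'a \<Rightarrow> 'a response \<Rightarrow> real" where
  "tilt \<alpha> x u r = (if r = Answer x then \<alpha> else if r = Answer u then 1 / \<alpha> else 1)"

text \<open>Multiplied out, since the difference of the two natural exponents may be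
  negative.\<close>

lemma prod_list_tilt:
  assumes "\<alpha> > 0" "x \<noteq> u"
  shows "prod_list (map (tilt \<alpha> x u) rs) * \<alpha> ^ count (answers rs) u = \<alpha> ^ count (answers rs) x"
  using assms
  by (induction rs) (auto simp: answers_Cons tilt_def field_simps split: response.splits)

lemma prod_list_tilt_ge_1:
  assumes "\<alpha> \<ge> 1" "x \<noteq> u" "count (answers rs) u \<le> count (answers rs) x"
  shows "1 \<le> prod_list (map (tilt \<alpha> x u) rs)"
proof -
  have "1 * \<alpha> ^ count (answers rs) u \<le> prod_list (map (tilt \<alpha> x u) rs) * \<alpha> ^ count (answers rs) u"
    using assms by (simp add: prod_list_tilt power_increasing)
  thus ?thesis using assms by (subst (asm) mult_le_cancel_right) auto
qed

lemma until_revealed_simps: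
  "until_revealed [] = []"
  "until_revealed (r # rs) = (if r = Revealed T2 then [r] else r # until_revealed rs)"
  by (simp_all add: until_revealed_def)

lemma revealed_append_until_revealed:
  assumes "Revealed T2 \<in> set rs"
  shows "revealed (L @ map (Pair v) (until_revealed rs))"
proof -
  have "Revealed T2 \<in> set (until_revealed rs)"
    using assms by (induction rs) (auto simp: until_revealed_simps)
  thus ?thesis by (force simp: revealed_def)
qed

lemma length_until_revealed_le: "length (until_revealed rs) \<le> length rs"
  by (simp add: until_revealed_def)

context weighted_graph
begin

subsection \<open>Distances and medians\<close>

lemma nbrs_subset: "nbrs v \<subseteq> pverts G"
  unfolding nbrs_def using in_arcsD2 by auto

lemma finite_nbrs: "finite (nbrs v)"
  using nbrs_subset finite_subset pair_finite_verts by blast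

lemma weight_nonneg: "e \<in> parcs G \<Longrightarrow> 0 \<le> w e"
  using weight_pos[of "fst e" "snd e"] by simp

lemma reach: "u \<in> pverts G \<Longrightarrow> v \<in> pverts G \<Longrightarrow> u \<rightarrow>\<^sup>*\<^bsub>with_proj G\<^esub> v"
  using connected_graph reachable_mk_symmetric_eq[OF sym_arcs]
  unfolding Digraph_Component.connected_def strongly_connected_def by auto

text \<open>Connectedness provides a path and nonnegative weights let a walk attain the minimum, so
  distances are finite and can be handled as reals through \<open>rdist\<close>.\<close>

lemma dist_realE:
  assumes "u \<in> pverts G" "v \<in> pverts G"
  obtains p where "awalk u p v" "\<mu> w u v = ereal (awalk_cost w p)"
  using min_cost_awalk[OF reach[OF assms], of w] weight_nonneg
  unfolding apath_def by auto

definition rdist :: "'a \<Rightarrow> 'a \<Rightarrow> real" where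
  "rdist u v = real_of_ereal (\<mu> w u v)"

lemma ereal_rdist:
  assumes "u \<in> pverts G" "v \<in> pverts G"
  shows "ereal (rdist u v) = \<mu> w u v"
  using dist_realE[OF assms] by (metis rdist_def real_of_ereal.simps(1))

lemma rdist_nonneg:
  assumes "u \<in> pverts G" "v \<in> pverts G"
  shows "0 \<le> rdist u v"
proof -
  obtain p where "awalk u p v" "\<mu> w u v = ereal (awalk_cost w p)"
    using dist_realE[OF assms] .
  thus ?thesis unfolding rdist_def
    using pos_cost_pos_awalk_cost[of u p v w] weight_nonneg by auto
qed

lemma rdist_arc_le:
  assumes "(v, u) \<in> parcs G" "x \<in> pverts G"
  shows "rdist v x \<le> w (v, u) + rdist u x"
proof -
  have uv: "u \<in> pverts G" "v \<in> pverts G" using assms in_arcsD1 in_arcsD2 by auto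
  obtain p where p: "awalk u p x" "\<mu> w u x = ereal (awalk_cost w p)"
    using dist_realE[OF uv(1) assms(2)] .
  hence "awalk v ((v, u) # p) x" using assms uv by (auto simp: awalk_Cons_iff)
  from min_cost_le_walk_cost[OF this, of w] p(2)
  show ?thesis
    by (simp add: ereal_rdist[symmetric] uv assms(2))
qed

lemma rdist_self: "v \<in> pverts G \<Longrightarrow> rdist v v = 0"
proof -
  assume v: "v \<in> pverts G"
  hence "awalk v [] v" by (auto simp: awalk_Nil_iff)
  from min_cost_le_walk_cost[OF this, of w] v rdist_nonneg[OF v v] show ?thesis
    by (simp add: ereal_rdist[symmetric])
qed

lemma mem_N_iff:
  assumes "(v, u) \<in> parcs G" "x \<in> pverts G"
  shows "x \<in> N v u \<longleftrightarrow> rdist v x = w (v, u) + rdist u x"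
proof -
  have uv: "u \<in> pverts G" "v \<in> pverts G" using assms in_arcsD1 in_arcsD2 by auto
  show ?thesis unfolding N_def using assms uv by (simp add: ereal_rdist[symmetric])
qed

text \<open>The first arc of a shortest walk leads to a correct answer, since the rest of the walk
  bounds the remaining distance. Nonemptiness makes \<open>pmf_of_set\<close> a genuine uniform
  distribution in \<open>query\<close>.\<close>

lemma correct_answers_nonempty:
  assumes "v \<in> pverts G" "t \<in> pverts G" "v \<noteq> t"
  shows "correct_answers t v \<noteq> {}"
proof -
  obtain p where p: "awalk v p t" "\<mu> w v t = ereal (awalk_cost w p)"
    using dist_realE[OF assms(1,2)] .
  then obtain u p' where p': "p = (v, u) # p'" "(v, u) \<in> parcs G" "awalk u p' t"
    using assms(3) by (cases p) (auto simp: awalk_Cons_iff awalk_Nil_iff)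
  have u: "u \<in> pverts G" using p'(2) in_arcsD2 by auto
  from min_cost_le_walk_cost[OF p'(3), of w] p(2) p'(1)
  have "rdist v t \<ge> w (v, u) + rdist u t"
    using assms u by (simp add: ereal_rdist[symmetric])
  with rdist_arc_le[OF p'(2) assms(2)] have "t \<in> N v u"
    using mem_N_iff[OF p'(2) assms(2)] by simp
  thus ?thesis using p'(2) unfolding correct_answers_def nbrs_def by auto
qed

lemma correct_answers_self: "t \<in> pverts G \<Longrightarrow> correct_answers t t = {}"
proof -
  assume t: "t \<in> pverts G"
  have False if "u \<in> correct_answers t t" for u
  proof -
    from that have u: "(t, u) \<in> parcs G" "t \<in> N t u"
      unfolding correct_answers_def nbrs_def by auto
    hence "u \<in> pverts G" using in_arcsD2 by auto
    hence "0 \<le> rdist u t" using rdist_nonneg t by auto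
    thus False using u mem_N_iff[OF u(1) t] rdist_self[OF t] weight_pos[OF u(1)] by simp
  qed
  thus ?thesis by auto
qed

lemma nbrs_nonempty:
  assumes "v \<in> pverts G" "card (pverts G) > 1"
  shows "nbrs v \<noteq> {}"
proof -
  obtain t where "t \<in> pverts G" "t \<noteq> v"
    using assms by (metis card_le_Suc0_iff_eq not_less One_nat_def pair_finite_verts)
  thus ?thesis using correct_answers_nonempty[OF assms(1), of t] unfolding correct_answers_def by auto
qed

lemma card_nbrs_le: "v \<in> pverts G \<Longrightarrow> card (nbrs v) \<le> max_degree"
  unfolding max_degree_def by (auto intro!: Max_ge)

lemma finite_correct_answers: "finite (correct_answers t v)"
  unfolding correct_answers_def using finite_nbrs by auto

lemma card_correct_answers_le: "v \<in> pverts G \<Longrightarrow> card (correct_answers t v) \<le> max_degree"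
  using card_nbrs_le[of v] card_mono[OF finite_nbrs, of "correct_answers t v" v]
  unfolding correct_answers_def by fastforce

lemma max_degree_pos:
  assumes "card (pverts G) > 1"
  shows "0 < max_degree"
proof -
  obtain v where v: "v \<in> pverts G" using assms by (metis card.empty equals0I not_less_zero)
  show ?thesis using card_nbrs_le[OF v] nbrs_nonempty[OF v assms] finite_nbrs[of v]
    by (metis card_gt_0_iff le_0_eq not_gr_zero)
qed

text \<open>A vertex minimizing the sum of the distances to \<open>S\<close> cannot have more than half of \<open>S\<close>
  behind one of its neighbours: moving to that neighbour would decrease the sum.\<close>

lemma exists_half_median:
  assumes S: "S \<subseteq> pverts G" and n: "card (pverts G) > 1"
  shows "\<exists>v\<in>pverts G. 2 * \<Gamma> S v \<le> card S"
proof -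
  have finS: "finite S" using S finite_subset pair_finite_verts by blast
  define \<Phi> where "\<Phi> v = (\<Sum>x\<in>S. rdist v x)" for v
  have ne: "pverts G \<noteq> {}" using n by auto
  define v where "v = arg_min_on \<Phi> (pverts G)"
  have v: "v \<in> pverts G" unfolding v_def
    by (rule arg_min_if_finite) (use ne in auto)
  have vmin: "\<Phi> v \<le> \<Phi> u" if "u \<in> pverts G" for u
    using that arg_min_least[OF pair_finite_verts ne] unfolding v_def by blast
  have "2 * card (N v u \<inter> S) \<le> card S" if u: "u \<in> nbrs v" for u
  proof -
    have arcs: "(v, u) \<in> parcs G" "(u, v) \<in> parcs G" 
      using u pair_sym_arcs unfolding nbrs_def by (auto intro: arcs_symmetric)
    have uG: "u \<in> pverts G" using arcs in_arcsD1 by auto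
    have w: "w (u, v) = w (v, u)" "w (v, u) > 0" using arcs weight_sym weight_pos by auto
    \<comment> \<open>Moving from \<open>v\<close> to \<open>u\<close> gains exactly
      \<open>w (v, u)\<close> for the points of \<open>N v u\<close> and loses at most
      \<open>w (v, u)\<close> for every other point of \<open>S\<close>.\<close>
    have "\<Phi> u \<le> (\<Sum>x\<in>S. rdist v x + (if x \<in> N v u then - w (v, u) else w (v, u)))"
      unfolding \<Phi>_def
    proof (rule sum_mono)
      fix x assume "x \<in> S"
      hence x: "x \<in> pverts G" using S by auto
      show "rdist u x \<le> rdist v x + (if x \<in> N v u then - w (v, u) else w (v, u))"
        using mem_N_iff[OF arcs(1) x] rdist_arc_le[OF arcs(2) x] w by simp
    qed
    also have "\<dots> = \<Phi> v + (real (card (S - N v u)) - real (card (N v u \<inter> S))) * w (v, u)"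
      unfolding \<Phi>_def using finS
      by (simp add: sum.distrib sum.If_cases Int_commute Diff_eq algebra_simps)
    finally have "0 \<le> (real (card (S - N v u)) - real (card (N v u \<inter> S))) * w (v, u)"
      using vmin[OF uG] by simp
    hence "card (N v u \<inter> S) \<le> card (S - N v u)" using w(2)
      by (simp add: zero_le_mult_iff)
    moreover have "card S = card (N v u \<inter> S) + card (S - N v u)"
      using card_Un_disjoint[of "N v u \<inter> S" "S - N v u"] finS
      by (metis Int_Diff_disjoint Int_Diff_Un Int_commute finite_Diff finite_Int)
    ultimately show ?thesis by simp
  qed
  moreover have "\<Gamma> S v \<in> (\<lambda>u. card (N v u \<inter> S)) ` nbrs v"
    unfolding \<Gamma>_def using finite_nbrs[of v] nbrs_nonempty[OF v n] by (intro Max_in) auto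
  ultimately have "2 * \<Gamma> S v \<le> card S" by auto
  thus ?thesis using v by blast
qed

text \<open>The minimum of \<open>\<Gamma> S\<close> is at most half of \<open>card S\<close> by
  \<open>exists_half_median\<close>; the approximation factor carries this over to
  \<open>v\<close>.\<close>

lemma card_restrict_median:
  assumes S: "S \<subseteq> pverts G" and n: "card (pverts G) > 1" and m: "is_median \<epsilon> S v"
    and "0 \<le> \<epsilon>" and u: "u \<in> nbrs v"
  shows "real (card (S \<inter> N v u)) \<le> (1 + \<epsilon>) / 2 * real (card S)"
proof -
  obtain x where x: "x \<in> pverts G" "2 * \<Gamma> S x \<le> card S" using exists_half_median[OF S n] by auto
  have "card (S \<inter> N v u) \<le> \<Gamma> S v" unfolding \<Gamma>_def using u finite_nbrs[of v]
    by (auto intro!: Max_ge simp: Int_commute)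
  hence "real (card (S \<inter> N v u)) \<le> (1 + \<epsilon>) * real (Min (\<Gamma> S ` pverts G))"
    using m unfolding is_median_def by linarith
  also have "\<dots> \<le> (1 + \<epsilon>) * real (\<Gamma> S x)"
    using x(1) \<open>0 \<le> \<epsilon>\<close> by (intro mult_left_mono) auto
  also have "\<dots> \<le> (1 + \<epsilon>) * (real (card S) / 2)"
    using x(2) \<open>0 \<le> \<epsilon>\<close> by (intro mult_left_mono) linarith+
  finally show ?thesis by simp
qed

subsection \<open>A batch of queries\<close>

definition directed_query :: "target \<Rightarrow> 'a \<Rightarrow> 'a \<Rightarrow> 'a response pmf" where
  "directed_query i t v =
     (if v = t then return_pmf (Revealed i)
      else map_pmf Answer (pmf_of_set (correct_answers t v)))"

lemma query_eq_directed:
  "query p1 t1 t2 v =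
     bernoulli_pmf p1 \<bind> (\<lambda>b. if b then directed_query T1 t1 v else directed_query T2 t2 v)"
  unfolding query_def directed_query_def by (intro bind_pmf_cong) auto

lemma nn_integral_query_le:
  fixes g :: "'a response \<Rightarrow> real"
  assumes "0 \<le> p1" "p1 \<le> 1" "0 \<le> A" "0 \<le> B"
    and "(\<integral>\<^sup>+ r. g r \<partial>directed_query T1 t1 v) \<le> ennreal A"
    and "(\<integral>\<^sup>+ r. g r \<partial>directed_query T2 t2 v) \<le> ennreal B"
  shows "(\<integral>\<^sup>+ r. g r \<partial>query p1 t1 t2 v) \<le> ennreal (p1 * A + (1 - p1) * B)"
proof -
  have "(\<integral>\<^sup>+ r. g r \<partial>query p1 t1 t2 v) =
    (\<integral>\<^sup>+ r. g r \<partial>directed_query T1 t1 v) * ennreal p1 +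
    (\<integral>\<^sup>+ r. g r \<partial>directed_query T2 t2 v) * ennreal (1 - p1)"
    using assms(1,2) unfolding query_eq_directed by simp
  also have "\<dots> \<le> ennreal A * ennreal p1 + ennreal B * ennreal (1 - p1)"
    using assms by (intro add_mono mult_right_mono) auto
  also have "\<dots> = ennreal (p1 * A + (1 - p1) * B)"
    using assms by (simp add: ennreal_mult[symmetric] ennreal_plus[symmetric] mult.commute del: ennreal_plus)
  finally show ?thesis .
qed

lemma nn_integral_directed_query:
  fixes g :: "'a response \<Rightarrow> real"
  assumes "v \<in> pverts G" "t \<in> pverts G" "v \<noteq> t" "\<And>r. 0 \<le> g r"
  shows "(\<integral>\<^sup>+ r. g r \<partial>directed_query i t v) =
    ennreal ((\<Sum>u\<in>correct_answers t v. g (Answer u)) / card (correct_answers t v))"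
proof -
  have "card (correct_answers t v) > 0"
    using correct_answers_nonempty[OF assms(1-3)] finite_correct_answers by (simp add: card_gt_0_iff)
  thus ?thesis
    using assms correct_answers_nonempty[OF assms(1-3)] finite_correct_answers[of t v]
    by (simp add: directed_query_def nn_integral_pmf_of_set sum_ennreal sum_nonneg
      divide_ennreal ennreal_of_nat_eq_real_of_nat)
qed

lemma set_directed_query:
  assumes "v \<in> pverts G" "t \<in> pverts G"
  shows "set_pmf (directed_query i t v) =
    (if v = t then {Revealed i} else Answer ` correct_answers t v)"
  using assms correct_answers_nonempty[OF assms] finite_correct_answers[of t v]
  by (simp add: directed_query_def)

lemma set_query_subset:
  assumes "v \<in> pverts G" "t1 \<in> pverts G" "t2 \<in> pverts G"
  shows "set_pmf (query p1 t1 t2 v) \<subseteq>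
    (if v = t1 then {Revealed T1} else Answer ` correct_answers t1 v) \<union>
    (if v = t2 then {Revealed T2} else Answer ` correct_answers t2 v)"
  unfolding query_eq_directed
  using set_directed_query[OF assms(1,2), of T1] set_directed_query[OF assms(1,3), of T2]
  by (auto split: if_splits)

text \<open>Common to all three cases: since \<open>\<delta> * c\<close> is at least 7, the batch
  size meets the threshold of \<open>power_le_inverse_square\<close>. Each case only has to exhibit
  a weight \<open>g\<close> with a small mean per query.\<close>

lemma replicate_query_bound:
  fixes g :: "'a response \<Rightarrow> real"
  assumes p1: "1 / 2 < p1" "p1 < 1" and n: "card (pverts G) > 1"
    and g: "\<And>r. 0 \<le> g r"
    and int: "(\<integral>\<^sup>+ r. g r \<partial>query p1 t1 t2 v) \<le> ennreal (1 - (1 - sqrt p1)\<^sup>2 / real max_degree)"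
    and A: "\<And>rs. rs \<in> A \<Longrightarrow> set rs \<subseteq> set_pmf (query p1 t1 t2 v) \<Longrightarrow> 1 \<le> prod_list (map g rs)"
  shows "measure_pmf.prob (replicate_pmf (batch_size p1) (query p1 t1 t2 v)) A
    \<le> 1 / (real (card (pverts G)))\<^sup>2"
proof -
  define \<delta> where "\<delta> = (1 - sqrt p1)\<^sup>2"
  have \<delta>: "0 \<le> \<delta>" "\<delta> \<le> 1" unfolding \<delta>_def using p1 by (auto simp: power_le_one)
  have D: "1 \<le> real max_degree" using max_degree_pos[OF n] by simp
  define c where "c = 7 * (1 + p1)\<^sup>2 / (p1 * (1 - p1)\<^sup>2)"
  let ?n = "real (card (pverts G))"
  have "2 * real max_degree * ln ?n \<le> 7 * (real max_degree * log 2 ?n)"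
  proof -
    have "ln ?n \<le> log 2 ?n"
      using n ln_less_self[of 2] ln_2_less_1 by (simp add: log_def field_simps mult_left_le)
    moreover have "0 \<le> ln ?n" using n by simp
    ultimately have "2 * ln ?n \<le> 7 * log 2 ?n" by linarith
    thus ?thesis using mult_left_mono[of "2 * ln ?n" "7 * log 2 ?n" "real max_degree"] by (simp add: mult_ac)
  qed
  also have "\<dots> \<le> (\<delta> * c) * (real max_degree * log 2 ?n)"
    using batch_constant_ge[of p1] p1 n unfolding \<delta>_def c_def
    by (intro mult_right_mono) auto
  also have "\<dots> \<le> \<delta> * real (batch_size p1)"
    using \<delta> unfolding batch_size_def c_def by (simp only: mult.assoc) (intro mult_left_mono real_nat_ceiling_ge)
  finally have k: "2 * real max_degree * ln ?n \<le> \<delta> * real (batch_size p1)" .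
  have "measure_pmf.prob (replicate_pmf (batch_size p1) (query p1 t1 t2 v)) A
    \<le> (1 - \<delta> / real max_degree) ^ batch_size p1"
  proof (rule replicate_pmf_exponential_Markov[OF int[folded \<delta>_def]])
    show "0 \<le> 1 - \<delta> / real max_degree" using \<delta> D by (simp add: divide_le_eq)
    fix rs assume "rs \<in> A" "set rs \<subseteq> set_pmf (query p1 t1 t2 v)"
    thus "1 \<le> prod_list (map (\<lambda>x. ennreal (g x)) rs)"
      using A by (simp add: prod_list_ennreal[OF g])
  qed
  also have "\<dots> \<le> 1 / ?n\<^sup>2"
    by (rule power_le_inverse_square[OF \<delta> D _ k]) (use n in auto)
  finally show ?thesis .
qed

text \<open>Quantifying over all admissible picks makes this a property of the responses alone, so
  its probability can be bounded for every pick rule at once, even one that depends on the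
  log.\<close>

definition good_batch :: "'a \<Rightarrow> 'a \<Rightarrow> 'a \<Rightarrow> 'a response list \<Rightarrow> bool" where
  "good_batch t1 t2 v rs \<longleftrightarrow> Revealed T2 \<in> set rs \<or>
     answers rs \<noteq> {#} \<and> (\<forall>u. admissible_pick t1 v (answers rs) u \<longrightarrow> u \<in> correct_answers t2 v)"

section \<open>Failure probability of one batch, case by case\<close>

abbreviation batch :: "real \<Rightarrow> 'a \<Rightarrow> 'a \<Rightarrow> 'a \<Rightarrow> 'a response list pmf" where
  "batch p1 t1 t2 v \<equiv> replicate_pmf (batch_size p1) (query p1 t1 t2 v)"

text \<open>The weight vanishes exactly on the revealing response, so its product is 1 on the event.
  Its mean is at most \<open>p1\<close>, and \<open>1 - p1\<close> dominates
  \<open>(1 - sqrt p1)\<^sup>2\<close>, even before division by the degree.\<close>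

lemma prob_not_revealed:
  assumes p1: "1 / 2 < p1" "p1 < 1" and n: "card (pverts G) > 1"
  shows "measure_pmf.prob (batch p1 t1 t2 t2) {rs. Revealed T2 \<notin> set rs}
    \<le> 1 / (real (card (pverts G)))\<^sup>2"
proof (rule replicate_query_bound[OF p1 n])
  let ?g = "\<lambda>r. if r = Revealed T2 then 0 else 1 :: real"
  show "0 \<le> ?g r" for r by simp
  have 1: "(\<integral>\<^sup>+ r. ?g r \<partial>directed_query T1 t1 t2) \<le> ennreal 1"
    by (rule order_trans[OF nn_integral_mono[where v = "\<lambda>_. 1"]]) auto
  have 2: "(\<integral>\<^sup>+ r. ?g r \<partial>directed_query T2 t2 t2) \<le> ennreal 0"
    by (simp add: directed_query_def)
  have D: "1 \<le> real max_degree" using max_degree_pos[OF n] by simp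
  have "(1 - sqrt p1)\<^sup>2 / real max_degree \<le> (1 - sqrt p1)\<^sup>2"
    using D by (simp add: divide_le_eq mult_left_le mult_right_le_one_le mult_le_cancel_left1)
  also have "\<dots> \<le> 1 - p1" using p1 by (intro one_minus_sqrt_square_le) auto
  finally have "p1 * 1 + (1 - p1) * 0 \<le> 1 - (1 - sqrt p1)\<^sup>2 / real max_degree" by simp
  with nn_integral_query_le[OF _ _ _ _ 1 2, of p1] p1
  show "(\<integral>\<^sup>+ r. ?g r \<partial>query p1 t1 t2 t2) \<le> ennreal (1 - (1 - sqrt p1)\<^sup>2 / real max_degree)"
    by (meson ennreal_leI order_trans le_numeral_extra(1,3) less_imp_le order_less_trans half_gt_zero_iff zero_less_one)
  fix rs :: "'a response list" assume "rs \<in> {rs. Revealed T2 \<notin> set rs}"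
  hence "prod_list (map ?g rs) = 1" by (induction rs) auto
  thus "1 \<le> prod_list (map ?g rs)" by simp
qed

text \<open>A query yields \<open>y\<close> with probability at least \<open>1 - p1\<close> divided
  by the number of correct answers for \<open>t2\<close>, and that number is at most the maximum
  degree.\<close>

lemma prob_no_distinguishing_answer:
  assumes p1: "1 / 2 < p1" "p1 < 1" and n: "card (pverts G) > 1"
    and v: "v \<in> pverts G" and t2: "t2 \<in> pverts G" "v \<noteq> t2"
    and y: "y \<in> correct_answers t2 v" "y \<notin> correct_answers t1 v"
  shows "measure_pmf.prob (batch p1 t1 t2 v) {rs. Answer y \<notin> set rs}
    \<le> 1 / (real (card (pverts G)))\<^sup>2"
proof (rule replicate_query_bound[OF p1 n])
  let ?g = "\<lambda>r. if r = Answer y then 0 else 1 :: real"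
  let ?E = "correct_answers t2 v"
  show g: "0 \<le> ?g r" for r by simp
  have 1: "(\<integral>\<^sup>+ r. ?g r \<partial>directed_query T1 t1 v) \<le> ennreal 1"
    by (rule order_trans[OF nn_integral_mono[where v = "\<lambda>_. 1"]]) auto
  have E: "0 < card ?E" "card ?E \<le> max_degree"
    using y finite_correct_answers card_correct_answers_le[OF v] by (auto simp: card_gt_0_iff)
  have "(\<Sum>u\<in>?E. ?g (Answer u)) = real (card ?E) - 1"
  proof -
    have "(\<Sum>u\<in>?E. ?g (Answer u)) = (\<Sum>u\<in>?E. 1 + (if u = y then - 1 else 0))"
      by (intro sum.cong) auto
    thus ?thesis using y finite_correct_answers[of t2 v] by (simp only: sum.distrib) simp
  qed
  hence 2: "(\<integral>\<^sup>+ r. ?g r \<partial>directed_query T2 t2 v) \<le> ennreal (1 - 1 / real (card ?E))"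
    using nn_integral_directed_query[OF v t2 g] E by (simp add: of_nat_diff diff_divide_distrib)
  have "(1 - sqrt p1)\<^sup>2 / real max_degree \<le> (1 - p1) / real (card ?E)"
    using p1 E by (intro frac_le one_minus_sqrt_square_le) auto
  hence "p1 * 1 + (1 - p1) * (1 - 1 / real (card ?E)) \<le> 1 - (1 - sqrt p1)\<^sup>2 / real max_degree"
    by (simp add: algebra_simps)
  moreover have "0 \<le> 1 - 1 / real (card ?E)" using E by simp
  ultimately show "(\<integral>\<^sup>+ r. ?g r \<partial>query p1 t1 t2 v) \<le> ennreal (1 - (1 - sqrt p1)\<^sup>2 / real max_degree)"
    using nn_integral_query_le[OF _ _ _ _ 1 2, of p1] p1
    by (meson ennreal_leI order_trans le_numeral_extra(1,3) less_imp_le order_less_trans half_gt_zero_iff zero_less_one)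
  fix rs :: "'a response list" assume "rs \<in> {rs. Answer y \<notin> set rs}"
  hence "prod_list (map ?g rs) = 1" by (induction rs) auto
  thus "1 \<le> prod_list (map ?g rs)" by simp
qed

text \<open>Per query, \<open>y\<close> has probability at least
  \<open>1 / card (correct_answers t1 v)\<close>, but \<open>x\<close> only \<open>p1\<close> times
  that, as it never comes from a query directed to \<open>t2\<close>. The tilt turns this gap into a
  geometric bound.\<close>

lemma prob_wrong_more_frequent:
  assumes p1: "1 / 2 < p1" "p1 < 1" and n: "card (pverts G) > 1"
    and v: "v \<in> pverts G" and t1: "t1 \<in> pverts G" "v \<noteq> t1" and t2: "t2 \<in> pverts G" "v \<noteq> t2"
    and sub: "correct_answers t2 v \<subseteq> correct_answers t1 v"
    and y: "y \<in> correct_answers t2 v" and x: "x \<in> correct_answers t1 v - correct_answers t2 v"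
  shows "measure_pmf.prob (batch p1 t1 t2 v) {rs. count (answers rs) y \<le> count (answers rs) x}
    \<le> 1 / (real (card (pverts G)))\<^sup>2"
proof -
  \<comment> \<open>The choice \<alpha> = \<open>1 / s\<close> minimizes
    \<open>p1 * \<alpha> + 1 / \<alpha>\<close>, which up to scaling is the part of the mean
    depending on \<alpha> when both answer sets have the same size.\<close>
  define s where "s = sqrt p1"
  have s: "0 < s" "s < 1" "p1 = s\<^sup>2" using p1 by (auto simp: s_def)
  define g :: "'a response \<Rightarrow> real" where "g = tilt (1 / s) x y"
  let ?E1 = "correct_answers t1 v" and ?E2 = "correct_answers t2 v"
  have xy: "x \<noteq> y" "y \<in> ?E1" using x y sub by auto
  have g: "0 \<le> g r" for r using s by (simp add: g_def tilt_def)
  have c: "0 < card ?E2" "card ?E2 \<le> card ?E1" "card ?E1 \<le> max_degree"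
    using y finite_correct_answers card_correct_answers_le[OF v] sub
    by (auto simp: card_gt_0_iff intro!: card_mono)
  hence c1: "0 < card ?E1" by simp
  have sum1: "(\<Sum>u\<in>?E1. g (Answer u)) = real (card ?E1) + (1 / s + s - 2)"
  proof -
    have "(\<Sum>u\<in>?E1. g (Answer u)) = (\<Sum>u\<in>?E1. 1 + ((if u = x then 1 / s - 1 else 0) + (if u = y then s - 1 else 0)))"
      using xy by (intro sum.cong) (auto simp: g_def tilt_def)
    thus ?thesis using xy x finite_correct_answers[of t1 v] by (simp add: sum.distrib)
  qed
  have sum2: "(\<Sum>u\<in>?E2. g (Answer u)) = real (card ?E2) + (s - 1)"
  proof -
    have "(\<Sum>u\<in>?E2. g (Answer u)) = (\<Sum>u\<in>?E2. 1 + (if u = y then s - 1 else 0))"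
      using x by (intro sum.cong) (auto simp: g_def tilt_def)
    thus ?thesis using y finite_correct_answers[of t2 v] by (simp add: sum.distrib)
  qed
  have 1: "(\<integral>\<^sup>+ r. g r \<partial>directed_query T1 t1 v) \<le> ennreal (1 + (1 / s + s - 2) / real (card ?E1))"
    using nn_integral_directed_query[OF v t1 g] c1 sum1 by (simp add: add_divide_distrib)
  have 2: "(\<integral>\<^sup>+ r. g r \<partial>directed_query T2 t2 v) \<le> ennreal (1 + (s - 1) / real (card ?E2))"
    using nn_integral_directed_query[OF v t2 g] c sum2 by (simp add: add_divide_distrib)
  have nonneg: "0 \<le> 1 + (1 / s + s - 2) / real (card ?E1)" "0 \<le> 1 + (s - 1) / real (card ?E2)"
  proof -
    have "1 / s + s - 2 = (1 - s)\<^sup>2 / s" using s by (simp add: field_simps power2_eq_square)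
    thus "0 \<le> 1 + (1 / s + s - 2) / real (card ?E1)" using s by simp
    have "1 - s \<le> real (card ?E2)" using c s by linarith
    thus "0 \<le> 1 + (s - 1) / real (card ?E2)" using c by (simp add: field_simps)
  qed
  \<comment> \<open>As \<open>s - 1\<close> is negative, replacing \<open>?E2\<close> by the larger
    \<open>?E1\<close> only increases the second mean. Over the common denominator the numerators
    combine to \<open>- (1 - s)\<^sup>2\<close>.\<close>
  have "(1 - s) / real (card ?E1) \<le> (1 - s) / real (card ?E2)" using c s by (intro divide_left_mono) auto
  hence "(s - 1) / real (card ?E2) \<le> (s - 1) / real (card ?E1)" by (simp add: diff_divide_distrib)
  hence "p1 * (1 + (1 / s + s - 2) / real (card ?E1)) + (1 - p1) * (1 + (s - 1) / real (card ?E2))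
    \<le> p1 * (1 + (1 / s + s - 2) / real (card ?E1)) + (1 - p1) * (1 + (s - 1) / real (card ?E1))"
    using p1 by (intro add_left_mono mult_left_mono) auto
  also have "\<dots> = 1 + (p1 * (1 / s + s - 2) + (1 - p1) * (s - 1)) / real (card ?E1)"
    using c1 by (simp add: field_simps)
  also have "p1 * (1 / s + s - 2) + (1 - p1) * (s - 1) = - (1 - s)\<^sup>2"
    using s by (simp add: field_simps power2_eq_square)
  also have "1 + - (1 - s)\<^sup>2 / real (card ?E1) \<le> 1 - (1 - s)\<^sup>2 / real max_degree"
  proof -
    have "(1 - s)\<^sup>2 / real max_degree \<le> (1 - s)\<^sup>2 / real (card ?E1)" using c c1 by (intro divide_left_mono) auto
    thus ?thesis by simp
  qed
  finally have bound: "p1 * (1 + (1 / s + s - 2) / real (card ?E1)) + (1 - p1) * (1 + (s - 1) / real (card ?E2))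
    \<le> 1 - (1 - sqrt p1)\<^sup>2 / real max_degree" unfolding s_def .
  have int: "(\<integral>\<^sup>+ r. g r \<partial>query p1 t1 t2 v) \<le> ennreal (1 - (1 - sqrt p1)\<^sup>2 / real max_degree)"
    using order_trans[OF nn_integral_query_le[OF _ _ nonneg 1 2] ennreal_leI[OF bound]] p1 by simp
  show ?thesis
  proof (rule replicate_query_bound[OF p1 n g int])
    fix rs :: "'a response list" assume "rs \<in> {rs. count (answers rs) y \<le> count (answers rs) x}"
    thus "1 \<le> prod_list (map g rs)"
      unfolding g_def using s xy(1) by (intro prod_list_tilt_ge_1) auto
  qed
qed

text \<open>The union bound over wrong answers in the third case costs a factor \<open>n\<close>,
  which is why the single events are bounded by \<open>1 / n\<^sup>2\<close>. A vertex equal to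
  \<open>t1\<close> but not to \<open>t2\<close> falls under the second case.\<close>

lemma prob_bad_batch:
  assumes p1: "1 / 2 < p1" "p1 < 1" and n: "card (pverts G) > 1"
    and v: "v \<in> pverts G" and t1: "t1 \<in> pverts G" and t2: "t2 \<in> pverts G"
  shows "measure_pmf.prob (batch p1 t1 t2 v) {rs. \<not> good_batch t1 t2 v rs}
    \<le> 1 / real (card (pverts G))"
proof -
  let ?P = "measure_pmf.prob (batch p1 t1 t2 v)"
  let ?Bad = "{rs. \<not> good_batch t1 t2 v rs}"
  let ?n = "real (card (pverts G))"
  have sq: "1 / ?n\<^sup>2 \<le> 1 / ?n" using n by (simp add: field_simps power2_eq_square)
  have supp: "?P A \<le> ?P B" if "A \<inter> set_pmf (batch p1 t1 t2 v) \<subseteq> B" for A B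
    using measure_pmf.finite_measure_mono[OF that, of "batch p1 t1 t2 v"] by (simp add: measure_Int_set_pmf)
  consider "v = t2" | y where "v \<noteq> t2" "y \<in> correct_answers t2 v" "y \<notin> correct_answers t1 v"
    | "v \<noteq> t2" "correct_answers t2 v \<subseteq> correct_answers t1 v" by blast
  thus ?thesis
  proof cases
    case 1
    have "?P ?Bad \<le> ?P {rs. Revealed T2 \<notin> set rs}" by (intro supp) (auto simp: good_batch_def)
    thus ?thesis using prob_not_revealed[OF p1 n, of t1 t2] 1 sq by simp
  next
    case (2 y)
    have "?P ?Bad \<le> ?P {rs. Answer y \<notin> set rs}"
    proof (intro supp subsetI)
      fix rs assume rs: "rs \<in> ?Bad \<inter> set_pmf (batch p1 t1 t2 v)"
      hence set: "set rs \<subseteq> set_pmf (query p1 t1 t2 v)" by (auto simp: set_replicate_pmf)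
      \<comment> \<open>One occurrence of \<open>y\<close> forces every admissible pick out of the
        correct answers for \<open>t1\<close>; such an answer can only stem from a query directed to
        \<open>t2\<close>.\<close>
      have "good_batch t1 t2 v rs" if y: "Answer y \<in> set rs"
        unfolding good_batch_def
      proof (intro disjI2 conjI allI impI)
        show "answers rs \<noteq> {#}" using y by (auto simp: answers_eq_empty_iff)
        fix u assume "admissible_pick t1 v (answers rs) u"
        moreover have "set_mset (answers rs) - correct_answers t1 v \<noteq> {}"
          using y 2 by (auto simp: in_answers_iff)
        ultimately have "Answer u \<in> set rs" "u \<notin> correct_answers t1 v"
          by (auto simp: admissible_pick_def in_answers_iff)
        thus "u \<in> correct_answers t2 v"
          using set set_query_subset[OF v t1 t2, of p1] by (auto split: if_splits)
      qed
      thus "rs \<in> {rs. Answer y \<notin> set rs}" using rs by auto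
    qed
    thus ?thesis using prob_no_distinguishing_answer[OF p1 n v t2 2] sq by linarith
  next
    case 3
    obtain y where y: "y \<in> correct_answers t2 v" using correct_answers_nonempty[OF v t2 3(1)] by auto
    have vt1: "v \<noteq> t1" using y 3(2) correct_answers_self[OF t1] by auto
    let ?X = "correct_answers t1 v - correct_answers t2 v"
    let ?F = "\<lambda>x. {rs. count (answers rs) y \<le> count (answers rs) x}"
    \<comment> \<open>An empty batch would be bad. In this case no response reveals a target, so a
      nonempty batch contains an answer.\<close>
    have k: "batch_size p1 > 0"
      using p1 n max_degree_pos[OF n] unfolding batch_size_def by simp
    have "?P ?Bad \<le> ?P (\<Union>x\<in>?X. ?F x)"
    proof (intro supp subsetI)
      fix rs assume rs: "rs \<in> ?Bad \<inter> set_pmf (batch p1 t1 t2 v)"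
      hence set: "set rs \<subseteq> set_pmf (query p1 t1 t2 v)" "length rs = batch_size p1"
        by (auto simp: set_replicate_pmf)
      have "set_pmf (query p1 t1 t2 v) \<subseteq> Answer ` correct_answers t1 v \<union> Answer ` correct_answers t2 v"
        using set_query_subset[OF v t1 t2, of p1] 3(1) vt1 by simp
      hence ans: "set rs \<subseteq> Answer ` correct_answers t1 v"
        using set(1) 3(2) by blast
      have ne: "answers rs \<noteq> {#}"
        using ans set(2) k by (cases rs) (auto simp: answers_eq_empty_iff)
      obtain u where u: "admissible_pick t1 v (answers rs) u" "u \<notin> correct_answers t2 v"
        using rs ne by (auto simp: good_batch_def)
      \<comment> \<open>Hence the pick is a most frequent answer, and a wrong \<open>u\<close> is at
        least as frequent as \<open>y\<close>.\<close>
      have "set_mset (answers rs) - correct_answers t1 v = {}"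
        using ans by (auto simp: in_answers_iff)
      hence "Answer u \<in> set rs" "count (answers rs) y \<le> count (answers rs) u"
        using u(1) by (auto simp: admissible_pick_def in_answers_iff)
      thus "rs \<in> (\<Union>x\<in>?X. ?F x)" using ans u(2) by auto
    qed
    also have "\<dots> \<le> (\<Sum>x\<in>?X. ?P (?F x))"
      using finite_correct_answers by (intro measure_pmf.finite_measure_subadditive_finite) auto
    also have "\<dots> \<le> (\<Sum>x\<in>?X. 1 / ?n\<^sup>2)"
      using prob_wrong_more_frequent[OF p1 n v t1 vt1 t2 3 y] by (intro sum_mono) auto
    also have "\<dots> = real (card ?X) * (1 / ?n\<^sup>2)" by simp
    also have "\<dots> \<le> ?n * (1 / ?n\<^sup>2)"
    proof -
      have "?X \<subseteq> pverts G" using nbrs_subset unfolding correct_answers_def by auto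
      thus ?thesis by (intro mult_right_mono) (auto intro: card_mono)
    qed
    also have "\<dots> = 1 / ?n" using n by (simp add: power2_eq_square)
    finally show ?thesis .
  qed
qed

subsection \<open>The loop\<close>

text \<open>Either \<open>t2\<close> is revealed and \<open>S\<close> stays as it is, or the pick is
  correct for \<open>t2\<close>, so that the intersection keeps \<open>t2\<close> and shrinks by the
  median property.\<close>

lemma update_state_good_batch:
  assumes S: "S \<subseteq> pverts G" "t2 \<in> S" and n: "card (pverts G) > 1"
    and v: "is_median \<epsilon> S v" and "0 \<le> \<epsilon>" and t1: "t1 \<in> pverts G" and pick: "pick_rule t1 pick"
    and rs: "good_batch t1 t2 v rs"
  obtains S' L' where "update_state pick v rs (S, L) = Some (S', L')" "S' \<subseteq> pverts G" "t2 \<in> S'"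
    "length L' \<le> length L + length rs" "revealed L' \<or> real (card S') \<le> (1 + \<epsilon>) / 2 * real (card S)"
proof -
  have vG: "v \<in> pverts G" using v by (simp add: is_median_def)
  let ?L = "L @ map (Pair v) (until_revealed rs)"
  have len: "length ?L \<le> length L + length rs" using length_until_revealed_le by simp
  show ?thesis
  proof (cases "Revealed T2 \<in> set rs")
    case True
    thus ?thesis
      using that[of S ?L] S len revealed_append_until_revealed[OF True, of L v] by (simp add: update_state_def)
  next
    case False
    let ?u = "pick S ?L v (answers rs)"
    from False rs have Q: "answers rs \<noteq> {#}"
      and u: "admissible_pick t1 v (answers rs) u \<Longrightarrow> u \<in> correct_answers t2 v" for u
      by (auto simp: good_batch_def)
    have "?u \<in> correct_answers t2 v"
      using pick vG Q by (intro u) (simp add: pick_rule_def)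
    hence "?u \<in> nbrs v" "t2 \<in> N v ?u" by (auto simp: correct_answers_def)
    thus ?thesis
      using that[of "S \<inter> N v ?u" ?L] S len False Q
        card_restrict_median[OF S(1) n v \<open>0 \<le> \<epsilon>\<close>, of ?u]
      by (auto simp: update_state_def Let_def)
  qed
qed

text \<open>Induction on \<open>j\<close>, a budget of iterations large enough to shrink
  \<open>S\<close> to one vertex. A revealed log satisfies the hypothesis for every
  \<open>j\<close>, since the loop has then stopped.\<close>

lemma loop_success_prob:
  assumes p1: "1 / 2 < p1" "p1 < 1" and \<epsilon>: "0 \<le> \<epsilon>" and n: "card (pverts G) > 1"
    and t1: "t1 \<in> pverts G" and med: "median_rule \<epsilon> med" and pick: "pick_rule t1 pick"
    and S: "S \<subseteq> pverts G" "t2 \<in> S"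
    and card: "revealed L \<or> real (card S) * ((1 + \<epsilon>) / 2) ^ j \<le> 1"
  shows "(1 - 2 / real (card (pverts G))) ^ j \<le>
    measure (measure_spmf (loop p1 t1 t2 med pick (S, L)))
      {s. detected t2 s \<and> num_queries s \<le> length L + j * batch_size p1}"
  using S card
proof (induction j arbitrary: S L)
  case (0 S L)
  have "finite S" using 0 finite_subset pair_finite_verts by blast
  moreover have le: "revealed L \<or> card S \<le> 1" using 0 by simp
  ultimately have "revealed L \<or> S = {t2}" using 0 by (auto simp: card_le_Suc0_iff_eq)
  moreover have "loop p1 t1 t2 med pick (S, L) = return_spmf (S, L)"
    using le by (subst loop.simps) auto
  ultimately show ?case
    by (simp add: measure_spmf_return_spmf measure_return detected_def num_queries_def indicator_def)
next
  case (Suc j S L)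
  let ?n = "real (card (pverts G))" and ?k = "batch_size p1"
  define A where "A L i = {s. detected t2 s \<and> num_queries s \<le> length L + i * ?k}" for L :: "'a query_log" and i
  have q: "0 \<le> 1 - 2 / ?n" "1 - 2 / ?n \<le> 1" using n by (auto simp: field_simps)
  have finS: "finite S" using Suc.prems finite_subset pair_finite_verts by blast
  show ?case
  proof (cases "card S > 1 \<and> \<not> revealed L")
    case False
    hence "revealed L \<or> S = {t2}"
      using Suc.prems finS by (auto simp: card_le_Suc0_iff_eq not_less)
    moreover have "(1 - 2 / ?n) ^ Suc j \<le> 1" using q by (intro power_le_one)
    moreover have "loop p1 t1 t2 med pick (S, L) = return_spmf (S, L)"
      using False by (subst loop.simps) auto
    ultimately show ?thesis
      by (simp add: measure_spmf_return_spmf measure_return detected_def num_queries_def indicator_def)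
  next
    case True
    define v where "v = med S L"
    have v: "is_median \<epsilon> S v" using med Suc.prems True by (simp add: median_rule_def v_def)
    have vG: "v \<in> pverts G" using v by (simp add: is_median_def)
    \<comment> \<open>An aborted iteration loses its probability mass and thus counts as a
      failure.\<close>
    define f where "f rs = (case update_state pick v rs (S, L) of None \<Rightarrow> return_pmf None
      | Some s \<Rightarrow> loop p1 t1 t2 med pick s)" for rs
    have eq: "loop p1 t1 t2 med pick (S, L) = bind_pmf (batch p1 t1 t2 v) f"
      using True by (subst loop.simps) (simp add: iteration_def bind_spmf_def bind_map_pmf Let_def v_def f_def[abs_def])
    have "measure_pmf.prob (batch p1 t1 t2 v) {rs. good_batch t1 t2 v rs} =
      1 - measure_pmf.prob (batch p1 t1 t2 v) {rs. \<not> good_batch t1 t2 v rs}"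
      using measure_pmf.prob_compl[of "{rs. \<not> good_batch t1 t2 v rs}" "batch p1 t1 t2 v"]
      by (simp add: Compl_eq_Diff_UNIV[symmetric] Collect_neg_eq)
    also have "\<dots> \<ge> 1 - 1 / ?n"
      using prob_bad_batch[OF p1 n vG t1, of t2] Suc.prems by auto
    also have "1 - 1 / ?n \<ge> 1 - 2 / ?n" by (simp add: divide_right_mono)
    finally have good: "1 - 2 / ?n \<le> measure_pmf.prob (batch p1 t1 t2 v) {rs. good_batch t1 t2 v rs}" .
    have "(1 - 2 / ?n) * (1 - 2 / ?n) ^ j \<le> measure (measure_spmf (bind_pmf (batch p1 t1 t2 v) f)) (A L (Suc j))"
    proof (rule measure_spmf_bind_pmf_ge[OF q(1) _ good])
      show "0 \<le> (1 - 2 / ?n) ^ j" using q by simp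
      fix rs assume rs: "rs \<in> {rs. good_batch t1 t2 v rs}" "rs \<in> set_pmf (batch p1 t1 t2 v)"
      hence len: "length rs = ?k" by (auto simp: set_replicate_pmf)
      obtain S' L' where s': "update_state pick v rs (S, L) = Some (S', L')" "S' \<subseteq> pverts G" "t2 \<in> S'"
        "length L' \<le> length L + length rs" "revealed L' \<or> real (card S') \<le> (1 + \<epsilon>) / 2 * real (card S)"
        using update_state_good_batch[OF Suc.prems(1,2) n v \<epsilon> t1 pick, of rs L] rs(1) by blast
      have "revealed L' \<or> real (card S') * ((1 + \<epsilon>) / 2) ^ j \<le> 1"
      proof (cases "revealed L'")
        case False
        hence "real (card S') * ((1 + \<epsilon>) / 2) ^ j \<le> (1 + \<epsilon>) / 2 * real (card S) * ((1 + \<epsilon>) / 2) ^ j"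
          using s'(5) \<epsilon> by (intro mult_right_mono) auto
        also have "\<dots> \<le> 1" using Suc.prems(3) True by (simp add: mult_ac)
        finally show ?thesis by simp
      qed simp
      from Suc.IH[OF s'(2,3) this]
      have "(1 - 2 / ?n) ^ j \<le> measure (measure_spmf (f rs)) (A L' j)"
        by (simp add: f_def s'(1) A_def)
      also have "\<dots> \<le> measure (measure_spmf (f rs)) (A L (Suc j))"
        using s'(4) len by (intro measure_spmf.finite_measure_mono) (auto simp: A_def)
      finally show "(1 - 2 / ?n) ^ j \<le> measure (measure_spmf (f rs)) (A L (Suc j))" .
    qed
    thus ?thesis by (simp add: eq A_def)
  qed
qed

text \<open>About \<open>log 2 n / \<eta>\<close> iterations shrink \<open>n\<close> vertices to
  one. For \<open>n > 2\<close> the logarithm is at least 1, so the roundings in \<open>J\<close>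
  and in the batch size are absorbed by the summands 1 in \<kappa> and in
  \<open>c + 1\<close>.\<close>

lemma algorithm_B_success_prob:
  fixes p1 \<epsilon> \<kappa> c :: real
  assumes p1: "1 / 2 < p1" "p1 < 1" and \<epsilon>: "0 \<le> \<epsilon>" "\<epsilon> < 1"
    and t1: "t1 \<in> pverts G" and t2: "t2 \<in> pverts G"
    and med: "median_rule \<epsilon> med" and pick: "pick_rule t1 pick"
  defines "\<kappa> \<equiv> 1 + 1 / log 2 (2 / (1 + \<epsilon>))" and "c \<equiv> 7 * (1 + p1)\<^sup>2 / (p1 * (1 - p1)\<^sup>2)"
  defines "n \<equiv> real (card (pverts G))"
  shows "(1 - 2 / n) powr (\<kappa> * log 2 n) \<le>
    measure (measure_spmf (algorithm_B p1 t1 t2 med pick))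
      {s. detected t2 s \<and> real (num_queries s) \<le> \<kappa> * (c + 1) * real max_degree * (log 2 n)\<^sup>2}"
    (is "_ \<le> measure ?M ?A")
proof -
  have card_pos: "card (pverts G) > 0" using t1 by (auto simp: card_gt_0_iff)
  consider "card (pverts G) = 1" | "card (pverts G) = 2" | "card (pverts G) > 2" using card_pos by linarith
  thus ?thesis
  proof cases
    \<comment> \<open>Both sides are 1: the loop stops at once with \<open>{t2}\<close> and no
      query, and on the left the exponent is zero while the base is -1.\<close>
    case 1
    hence "pverts G = {t2}" using t2 by (auto simp: card_1_singleton_iff)
    thus ?thesis using 1
      by (simp add: algorithm_B_def n_def, subst loop.simps)
        (simp add: measure_spmf_return_spmf measure_return detected_def num_queries_def)
  next
    \<comment> \<open>The base \<open>1 - 2 / n\<close> is zero, and so is its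
      \<open>powr\<close>.\<close>
    case 2
    thus ?thesis by (simp add: n_def)
  next
    case 3
    hence n: "n > 2" "card (pverts G) > 1" by (auto simp: n_def)
    define \<eta> where "\<eta> = log 2 (2 / (1 + \<epsilon>))"
    have \<eta>: "\<eta> > 0" unfolding \<eta>_def using \<epsilon> by (simp add: field_simps)
    have l1: "1 \<le> log 2 n" using n by (simp add: le_log_iff)
    define J where "J = nat \<lceil>log 2 n / \<eta>\<rceil>"
    have J: "log 2 n / \<eta> \<le> real J" unfolding J_def by (rule real_nat_ceiling_ge)
    have Jle: "real J \<le> \<kappa> * log 2 n"
    proof -
      have "real J \<le> log 2 n / \<eta> + 1" unfolding J_def using l1 \<eta> by (simp add: of_nat_ceiling)
      thus ?thesis using l1 by (simp add: \<kappa>_def \<eta>_def algebra_simps)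
    qed
    have D: "1 \<le> real max_degree" using max_degree_pos[OF n(2)] by simp
    have c: "c > 0" using p1 by (simp add: c_def)
    have k: "real (batch_size p1) \<le> (c + 1) * (real max_degree * log 2 n)"
    proof -
      have "1 \<le> real max_degree * log 2 n" using D l1 mult_mono[of 1 "real max_degree" 1 "log 2 n"] by simp
      moreover have "real (batch_size p1) \<le> c * (real max_degree * log 2 n) + 1"
        using c D l1 unfolding batch_size_def c_def[symmetric] n_def[symmetric]
        by (simp add: of_nat_ceiling mult.assoc)
      ultimately show ?thesis by (simp add: algebra_simps)
    qed
    have "log 2 n \<le> real J * \<eta>" using J \<eta> by (simp add: divide_le_eq)
    also have "\<dots> = log 2 ((2 / (1 + \<epsilon>)) ^ J)"
      unfolding \<eta>_def using \<epsilon> by (subst log_nat_power) auto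
    finally have "n \<le> (2 / (1 + \<epsilon>)) ^ J" using n \<epsilon> by simp
    hence card: "n * ((1 + \<epsilon>) / 2) ^ J \<le> 1"
      using \<epsilon> by (simp add: power_divide field_simps)
    have "(1 - 2 / n) powr (\<kappa> * log 2 n) \<le> (1 - 2 / n) powr real J"
      using n Jle by (intro powr_mono') auto
    also have "\<dots> = (1 - 2 / n) ^ J" using n by (intro powr_realpow) simp
    also have "\<dots> \<le> measure ?M {s. detected t2 s \<and> num_queries s \<le> length ([] :: 'a query_log) + J * batch_size p1}"
      unfolding algorithm_B_def n_def using card t2
      by (intro loop_success_prob[OF p1 \<epsilon>(1) n(2) t1 med pick]) (auto simp: n_def)
    also have "\<dots> \<le> measure ?M ?A"
    proof (intro measure_spmf.finite_measure_mono)
      have "real J * real (batch_size p1) \<le> (\<kappa> * log 2 n) * ((c + 1) * (real max_degree * log 2 n))"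
        using Jle k l1 D by (intro mult_mono) auto
      also have "\<dots> = \<kappa> * (c + 1) * real max_degree * (log 2 n)\<^sup>2" by (simp add: power2_eq_square)
      finally have b: "real (J * batch_size p1) \<le> \<kappa> * (c + 1) * real max_degree * (log 2 n)\<^sup>2" by simp
      show "{s. detected t2 s \<and> num_queries s \<le> length ([] :: 'a query_log) + J * batch_size p1} \<subseteq> ?A"
        using b by (auto intro: order_trans[OF of_nat_mono])
    qed simp
    finally show ?thesis .
  qed
qed

end

theorem theorem6:
  fixes p1 \<epsilon> :: real
  assumes "1 / 2 < p1" and "p1 < 1" and "0 \<le> \<epsilon>" and "\<epsilon> < 1"
  shows "\<exists>C K :: real. C > 0 \<and> K > 0 \<and>
    (\<forall>(G :: 'a pair_pre_digraph) w t1 t2 med pick.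
       weighted_graph G w \<and> t1 \<in> pverts G \<and> t2 \<in> pverts G \<and>
       weighted_graph.median_rule G w \<epsilon> med \<and> weighted_graph.pick_rule G w t1 pick \<longrightarrow>
       (let n = real (card (pverts G)); \<Delta> = real (weighted_graph.max_degree G) in
        measure (measure_spmf (weighted_graph.algorithm_B G w p1 t1 t2 med pick))
          {s. detected t2 s \<and> real (num_queries s) \<le> C * \<Delta> * (log 2 n)\<^sup>2}
        \<ge> (1 - 2 / n) powr (K * log 2 n)))"
proof -
  \<comment> \<open>Both constants depend only on \<open>p1\<close> and \<epsilon>, so they can be
    fixed before the graph, the targets and the rules.\<close>
  define K where "K = 1 + 1 / log 2 (2 / (1 + \<epsilon>))"
  define C where "C = K * (7 * (1 + p1)\<^sup>2 / (p1 * (1 - p1)\<^sup>2) + 1)"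
  have "0 < log 2 (2 / (1 + \<epsilon>))" using assms by (simp add: field_simps)
  hence K: "K > 0" unfolding K_def by (simp add: add_pos_pos)
  have "0 < 7 * (1 + p1)\<^sup>2 / (p1 * (1 - p1)\<^sup>2)" using assms by simp
  hence C: "C > 0" unfolding C_def using K by (intro mult_pos_pos) linarith+
  show ?thesis
    using K C weighted_graph.algorithm_B_success_prob[OF _ assms, folded K_def, folded C_def]
    by (intro exI[of _ C] exI[of _ K]) (auto simp: Let_def)
qed

end
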